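(* Let $\eta=(\eta_1,\dots,\eta_r)$ be a composition of $n$ (i.e. $\eta_i\in\mathbb{N}=\{1,2,\dots\}$ and $\eta_1+\dots+\eta_r=n$). Then, as formal power series in $t$ with coefficients in $\mathbb{Q}(q)$, $$\frac{C_{S_{\eta}}(q,t)}{\prod_{i=0}^n (1-q^i t)} = \sum_{k\geq 0} \prod_{i=1}^r \binom{k+\eta_i}{\eta_i}_q t^k = \mathrm{Ehr}_{\Delta_{\eta},\boldsymbol{\mu}_{\eta}}(q,t).$$
   Context: $S_\eta$ is the set of multiset permutations $w=w_1\dots w_n$ of the multiset containing $\eta_j$ copies of $j$ for each $j\in[r]$. Its descent set is $\mathrm{Des}(w)=\{i\in[n-1]: w_i>w_{i+1}\}$, $\mathrm{maj}(w)=\sum_{i\in\mathrm{Des}(w)} i$, $\mathrm{des}(w)=|\mathrm{Des}(w)|$, and $C_{S_\eta}(q,t)=\sum_{w\in S_\eta} q^{\mathrm{maj}(w)}t^{\mathrm{des}(w)}$. The $q$-binomial coefficient is $\binom{m}{j}_q=\frac{[m]_q!}{[m-j]_q![j]_q!}$ with $[m]_q!=[m]_q\cdots[1]_q$, $[m]_q=\frac{1-q^m}{1-q}$. $\Delta_m=\{x\in\mathbb{R}^m: x_i\ge 0,\ x_1+\dots+x_m\le 1\}$ is the standard simplex. For $k\ge 0$ and $x\in k\Delta_m\cap\mathbb{Z}^m$ define the weight $\mu_{k,m}(x)=\sum_{i=1}^m\bigl(k-\sum_{l=i}^m x_l\bigr)$ (i.e. the coordinate sum of $\phi_{k,m}(x)=(k-\sum_{l=1}^m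 x_l,\,k-\sum_{l=2}^m x_l,\dots,k-x_m)$). Let $\Delta_\eta=\Delta_{\eta_1}\times\dots\times\Delta_{\eta_r}\subset\mathbb{R}^n$ and for $x=(x_1,\dots,x_r)\in k\Delta_\eta\cap\mathbb{Z}^n$ with $x_i\in k\Delta_{\eta_i}$ put $\mu_{k,\eta}(x)=\sum_{i=1}^r\mu_{k,\eta_i}(x_i)$. The weighted Ehrhart series is $\mathrm{Ehr}_{\Delta_\eta,\boldsymbol{\mu}_\eta}(q,t)=\sum_{k\ge0}\sum_{x\in k\Delta_\eta\cap\mathbb{Z}^n} q^{\mu_{k,\eta}(x)}t^k$. *)

theory Defs
  imports
    "HOL-Computational_Algebra.Computational_Algebra"
    "HOL-Combinatorics.Multiset_Permutations"
begin

type_synonym rat_fun = "rat poly fract"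

text \<open>The field \<open>\<rat>(q)\<close> is the fraction field of \<open>\<rat>[q]\<close>; \<open>qv\<close> is the indeterminate \<open>q\<close>, and the
  variable \<open>t\<close> of power series over it is \<open>fps_X\<close>.\<close>

definition qv :: rat_fun where
  "qv = Fract [:0, 1:] 1"

definition q_int :: "nat \<Rightarrow> rat_fun" where
  "q_int m = (1 - qv ^ m) / (1 - qv)"

definition q_fact :: "nat \<Rightarrow> rat_fun" where
  "q_fact m = (\<Prod>i=1..m. q_int i)"

definition q_binomial :: "nat \<Rightarrow> nat \<Rightarrow> rat_fun" where
  "q_binomial m j = q_fact m / (q_fact (m - j) * q_fact j)"

text \<open>A composition \<open>\<eta> = (\<eta>\<^sub>1, \<dots>, \<eta>\<^sub>r)\<close> is a list of length \<open>r\<close>, so \<open>\<eta>\<^sub>j\<close> is \<open>\<eta> ! (j - 1)\<close>;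
  words and vectors are lists with the same index shift.\<close>

definition multiset_perms :: "nat list \<Rightarrow> nat list set" where
  "multiset_perms \<eta> =
     permutations_of_multiset (\<Sum>j\<in>{1..length \<eta>}. replicate_mset (\<eta> ! (j - 1)) j)"

definition Des :: "nat list \<Rightarrow> nat set" where
  "Des w = {i \<in> {1..length w - 1}. w ! (i - 1) > w ! i}"

definition des :: "nat list \<Rightarrow> nat" where
  "des w = card (Des w)"

definition maj :: "nat list \<Rightarrow> nat" where
  "maj w = (\<Sum>i\<in>Des w. i)"

definition C_poly :: "nat list \<Rightarrow> rat_fun fps" where
  "C_poly \<eta> = (\<Sum>w\<in>multiset_perms \<eta>. fps_const (qv ^ maj w) * fps_X ^ des w)"

text \<open>\<open>\<real>\<^sup>m\<close> is the set of real lists of length \<open>m\<close>.  A point of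
  \<open>\<real>\<^sup>n = \<real>\<^bsup>\<eta>\<^sub>1\<^esup> \<times> \<dots> \<times> \<real>\<^bsup>\<eta>\<^sub>r\<^esup>\<close> is kept as the list \<open>(x\<^sub>1, \<dots>, x\<^sub>r)\<close> of its blocks.\<close>

definition std_simplex :: "nat \<Rightarrow> real list set" where
  "std_simplex m = {x. length x = m \<and> (\<forall>c\<in>set x. 0 \<le> c) \<and> sum_list x \<le> 1}"

definition simplex_prod :: "nat list \<Rightarrow> real list list set" where
  "simplex_prod \<eta> = listset (map std_simplex \<eta>)"

definition dilate :: "nat \<Rightarrow> real list list set \<Rightarrow> real list list set" where
  "dilate k P = map (map (\<lambda>c. real k * c)) ` P"

definition lattice_points :: "real list list set \<Rightarrow> int list list set" where
  "lattice_points P = {x. map (map real_of_int) x \<in> P}"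

definition mu :: "nat \<Rightarrow> nat \<Rightarrow> int list \<Rightarrow> int" where
  "mu k m x = (\<Sum>i=1..m. int k - (\<Sum>l=i..m. x ! (l - 1)))"

definition mu_prod :: "nat list \<Rightarrow> nat \<Rightarrow> int list list \<Rightarrow> int" where
  "mu_prod \<eta> k x = (\<Sum>i=1..length \<eta>. mu k (\<eta> ! (i - 1)) (x ! (i - 1)))"

definition weighted_Ehr ::
    "real list list set \<Rightarrow> (nat \<Rightarrow> int list list \<Rightarrow> int) \<Rightarrow> rat_fun fps" where
  "weighted_Ehr P \<mu> = Abs_fps (\<lambda>k. \<Sum>x\<in>lattice_points (dilate k P). qv powi \<mu> k x)"

end

theory Submission
  imports Defs
begin

text \<open>
  For a word \<open>w\<close> call a sequence \<open>k \<ge> f\<^sub>1 \<ge> \<dots> \<ge> f\<^sub>n \<ge> 0\<close> compatible with \<open>w\<close> if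
  \<open>f\<^sub>i > f\<^sub>i\<^sub>+\<^sub>1\<close> at every descent \<open>i\<close> of \<open>w\<close>, and let \<open>F\<^sub>w(k)\<close> be the sum of
  \<open>q\<close> to the power \<open>f\<^sub>1 + \<dots> + f\<^sub>n\<close> over these sequences
  (\<open>compat_gf q w k\<close> below). Splitting off the first letter turns
  \<open>F\<^sub>w\<close> into partial sums combined with the substitution \<open>t \<mapsto> q t\<close>, which gives
  \<open>\<Sum>\<^sub>k F\<^sub>w(k) t\<^sup>k = q\<^bsup>maj w\<^esup> t\<^bsup>des w\<^esup> / \<Prod>\<^sub>i (1 - q\<^sup>i t)\<close>.
  On the other hand, the positions where \<open>f\<close> takes its maximal admissible value \<open>k + 1\<close> form a weakly
  increasing prefix of \<open>w\<close>, which is determined by its multiset of letters. Summed over all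
  permutations of a multiset, this is a recursion in \<open>k\<close> that factors over the letters and is
  solved by the product of \<open>q\<close>-binomial coefficients. For the Ehrhart series, the lattice points of
  \<open>(k + 1) \<Delta>\<^bsub>m + 1\<^esub>\<close> are split by whether their coordinate sum is \<open>k + 1\<close>; this is
  the \<open>q\<close>-Pascal recursion.
\<close>

section \<open>Generating functions of compatible sequences\<close>

text \<open>The summation index \<open>j\<close> is the first entry of the sequence. It bounds the
  remaining entries, with \<open>j - 1\<close> in place of \<open>j\<close> at a descent, so
  \<open>j = 0\<close> contributes nothing there.\<close>

fun compat_gf :: "'a::comm_semiring_1 \<Rightarrow> 'b::linorder list \<Rightarrow> nat \<Rightarrow> 'a" where
  "compat_gf q [] k = 1"
| "compat_gf q [a] k = (\<Sum>j\<le>k. q ^ j)"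
| "compat_gf q (a # b # w) k = (\<Sum>j\<le>k. q ^ j *
     (if b < a then case j of 0 \<Rightarrow> 0 | Suc i \<Rightarrow> compat_gf q (b # w) i else compat_gf q (b # w) j))"

lemma Des_Cons_Cons: "Des (a # b # w) = (if b < a then {1} else {}) \<union> Suc ` Des (b # w)"
proof (rule set_eqI)
  fix i show "i \<in> Des (a # b # w) \<longleftrightarrow> i \<in> (if b < a then {1} else {}) \<union> Suc ` Des (b # w)"
  proof (cases i)
    case (Suc j)
    then show ?thesis by (cases j) (auto simp: Des_def)
  qed (auto simp: Des_def)
qed

lemma finite_Des [simp]: "finite (Des w)"
  by (simp add: Des_def)

lemma zero_notin_Des [simp]: "0 \<notin> Des w"
  by (simp add: Des_def)

lemma des_Cons_Cons: "des (a # b # w) = of_bool (b < a) + des (b # w)"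
proof -
  have "card (Suc ` Des (b # w)) = card (Des (b # w))"
    by (simp add: card_image)
  then show ?thesis by (auto simp: des_def Des_Cons_Cons card_insert_if)
qed

text \<open>Every descent of \<open>b # w\<close> moves one place to the right, which costs one unit
  per descent. Substituting \<open>q t\<close> for \<open>t\<close> in \<open>q^maj t^des\<close>
  has the same effect.\<close>

lemma maj_Cons_Cons: "maj (a # b # w) = of_bool (b < a) + maj (b # w) + des (b # w)"
proof -
  have "(\<Sum>i\<in>Suc ` Des (b # w). i) = (\<Sum>i\<in>Des (b # w). i) + card (Des (b # w))"
    by (simp add: sum.reindex sum_Suc)
  moreover have "Suc 0 \<notin> Suc ` Des (b # w)" by auto
  ultimately show ?thesis by (simp add: des_def maj_def Des_Cons_Cons)
qed

lemma partial_sums_fps_mult: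
  fixes g :: "nat \<Rightarrow> 'a::comm_ring_1"
  shows "Abs_fps (\<lambda>k. \<Sum>j\<le>k. g j) * (1 - fps_X) = Abs_fps g"
proof (rule fps_ext)
  fix n show "(Abs_fps (\<lambda>k. \<Sum>j\<le>k. g j) * (1 - fps_X)) $ n = Abs_fps g $ n"
    by (cases n) (simp_all add: right_diff_distrib)
qed

lemma geometric_fps_mult:
  fixes c :: "'a::comm_ring_1"
  shows "Abs_fps (\<lambda>k. c ^ k) * (1 - fps_const c * fps_X) = 1"
proof (rule fps_ext)
  fix n show "(Abs_fps (\<lambda>k. c ^ k) * (1 - fps_const c * fps_X)) $ n = 1 $ n"
    by (cases n) (simp_all add: right_diff_distrib mult.left_commute[of _ "fps_const c"])
qed

text \<open>Prepending a letter turns a series \<open>G(t)\<close> into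
  \<open>G(q t) / (1 - t)\<close>, with an extra factor \<open>q t\<close> at a descent. The
  substitution raises each \<open>1 - q^i t\<close> to \<open>1 - q^(i+1) t\<close>, and the partial
  sums supply the factor \<open>1 - t\<close> for \<open>i = 0\<close>.\<close>

lemma compat_gf_fps:
  fixes q :: "'a::field"
  shows "Abs_fps (compat_gf q w) * (\<Prod>i=0..length w. 1 - fps_const (q ^ i) * fps_X)
           = fps_const (q ^ maj w) * fps_X ^ des w"
proof (induction w rule: induct_list012)
  case 1
  show ?case using geometric_fps_mult[of "1 :: 'a"] by (simp add: maj_def des_def Des_def)
next
  case (2 a)
  have "Abs_fps (compat_gf q [a]) * (1 - fps_X) = Abs_fps (\<lambda>k. q ^ k)"
    using partial_sums_fps_mult[of "\<lambda>k. q ^ k"] by (simp add: compat_gf.simps(2)[abs_def])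
  then show ?case using geometric_fps_mult[of q]
    by (simp add: maj_def des_def Des_def mult.assoc[symmetric] del: compat_gf.simps)
next
  case (3 a b w)
  \<comment> \<open>Composition with \<open>s\<close> multiplies the coefficient of index
    \<open>j\<close> by \<open>q ^ j\<close>.\<close>
  define s where "s = fps_const q * (fps_X :: 'a fps)"
  define G where "G = Abs_fps (compat_gf q (b # w))"
  define P where "P = (\<Prod>i=0..length (b # w). 1 - fps_const (q ^ i) * (fps_X :: 'a fps))"
  have s0: "s $ 0 = 0" by (simp add: s_def)
  have "Abs_fps (compat_gf q (a # b # w)) * (1 - fps_X) = Abs_fps (\<lambda>j. q ^ j *
     (if b < a then case j of 0 \<Rightarrow> 0 | Suc i \<Rightarrow> compat_gf q (b # w) i else compat_gf q (b # w) j))"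
    unfolding compat_gf.simps(3)[abs_def] by (rule partial_sums_fps_mult)
  \<comment> \<open>At a descent the factor \<open>s\<close> shifts the index from
    \<open>j - 1\<close> to \<open>j\<close> and completes \<open>q ^ (j - 1)\<close> to
    \<open>q ^ j\<close>.\<close>
  also have "\<dots> = (if b < a then s else 1) * fps_compose G s"
    by (rule fps_ext) (simp add: s_def G_def fps_compose_linear mult.assoc split: nat.splits)
  finally have *: "Abs_fps (compat_gf q (a # b # w)) * (1 - fps_X) = s ^ of_bool (b < a) * fps_compose G s"
    by simp
  have "fps_compose P s = (\<Prod>i=0..length (b # w). fps_compose (1 - fps_const (q ^ i) * fps_X) s)"
    unfolding P_def by (rule fps_compose_prod_distrib) (rule s0)
  also have "\<dots> = (\<Prod>i=0..length (b # w). 1 - fps_const (q ^ Suc i) * fps_X)"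
    by (simp add: fps_compose_sub_distrib fps_compose_mult_distrib s0 s_def mult_ac flip: fps_const_mult)
  also have "\<dots> * (1 - fps_X) = (\<Prod>i=0..length (a # b # w). 1 - fps_const (q ^ i) * fps_X)"
    by (simp only: length_Cons prod.atLeast0_atMost_Suc_shift) (simp add: mult.commute)
  finally have **: "(\<Prod>i=0..length (a # b # w). 1 - fps_const (q ^ i) * fps_X) = (1 - fps_X) * fps_compose P s"
    by (simp add: mult.commute)
  have "Abs_fps (compat_gf q (a # b # w)) * (\<Prod>i=0..length (a # b # w). 1 - fps_const (q ^ i) * fps_X)
      = s ^ of_bool (b < a) * fps_compose G s * fps_compose P s"
    unfolding ** mult.assoc[symmetric] * ..
  also have "\<dots> = s ^ of_bool (b < a) * fps_compose (G * P) s"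
    by (simp add: fps_compose_mult_distrib s0 mult.assoc)
  also have "G * P = fps_const (q ^ maj (b # w)) * fps_X ^ des (b # w)"
    using 3(2) by (simp add: G_def P_def)
  also have "fps_compose \<dots> s = fps_const (q ^ maj (b # w)) * s ^ des (b # w)"
    by (simp add: fps_compose_mult_distrib s0 flip: fps_compose_power)
  also have "s ^ of_bool (b < a) * \<dots> = fps_const (q ^ maj (a # b # w)) * fps_X ^ des (a # b # w)"
    unfolding s_def maj_Cons_Cons des_Cons_Cons
    by (simp add: power_mult_distrib power_add fps_const_power mult_ac)
  finally show ?case .
qed

text \<open>Here \<open>s\<close> is the number of entries equal to \<open>Suc k\<close>. The later
  entries are at most \<open>k\<close>, so a descent between positions \<open>s\<close> and
  \<open>s + 1\<close> imposes no further condition.\<close>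

lemma compat_gf_Suc:
  fixes q :: "'a::comm_semiring_1"
  shows "compat_gf q w (Suc k) = (\<Sum>s | s \<le> length w \<and> sorted (take s w). (q ^ Suc k) ^ s * compat_gf q (drop s w) k)"
proof (induction w rule: induct_list012)
  case 1
  have "{s. s \<le> length [] \<and> sorted (take s [])} = {0}" by auto
  then show ?case by simp
next
  case (2 a)
  have "{s. s \<le> length [a] \<and> sorted (take s [a])} = {0, 1}" by (auto simp: le_Suc_eq)
  then show ?case by simp
next
  case (3 a b w)
  let ?A = "{s. s \<le> length (b # w) \<and> sorted (take s (b # w))}"
  let ?B = "{s. s \<le> length (a # b # w) \<and> sorted (take s (a # b # w))}"
  let ?f = "\<lambda>w s. (q ^ Suc k) ^ s * compat_gf q (drop s w) k"
  have fin: "finite ?A" by simp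
  \<comment> \<open>The summand with first entry \<open>Suc k\<close> is split off; the rest is the
    term \<open>s = 0\<close>.\<close>
  have rec: "compat_gf q (a # b # w) (Suc k) = compat_gf q (a # b # w) k +
      q ^ Suc k * (if b < a then compat_gf q (b # w) k else compat_gf q (b # w) (Suc k))" by simp
  show ?case
  proof (cases "b < a")
    case True
    have "?B = {0, 1}"
    proof (intro equalityI subsetI)
      fix s assume "s \<in> ?B"
      then show "s \<in> {0, 1}" using True by (cases s; cases "s - 1") auto
    qed auto
    then show ?thesis unfolding rec using True by simp
  next
    case False
    have "?B = insert 0 (Suc ` ?A)"
    proof (intro equalityI subsetI)
      fix s assume s: "s \<in> ?B"
      show "s \<in> insert 0 (Suc ` ?A)"
        using s by (cases s) auto
    next
      fix s assume "s \<in> insert 0 (Suc ` ?A)"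
      then consider "s = 0" | i where "s = Suc i" "i \<in> ?A" by auto
      then show "s \<in> ?B"
      proof cases
        case 2
        then show ?thesis using False by (cases i) auto
      qed auto
    qed
    then have "sum (?f (a # b # w)) ?B = ?f (a # b # w) 0 + (\<Sum>s\<in>?A. ?f (a # b # w) (Suc s))"
      using fin by (simp add: sum.reindex)
    also have "(\<Sum>s\<in>?A. ?f (a # b # w) (Suc s)) = q ^ Suc k * (\<Sum>s\<in>?A. ?f (b # w) s)"
      by (simp add: sum_distrib_left mult_ac)
    finally show ?thesis unfolding rec 3(2) using False by simp
  qed
qed

text \<open>Only the zero sequence is available, and it tolerates no descent. This starts the
  recursion in \<open>k\<close>.\<close>

lemma compat_gf_0: "compat_gf q w 0 = of_bool (sorted w)"
proof (induction w rule: induct_list012)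
  case (3 a b w)
  have "compat_gf q (a # b # w) 0 = (if b < a then 0 else compat_gf q (b # w) 0)"
    by simp
  also have "\<dots> = of_bool (sorted (a # b # w))"
    unfolding 3(2) sorted2 by (simp add: not_less[symmetric] del: sorted_simps)
  finally show ?case .
qed auto

section \<open>Submultisets and sorted prefixes\<close>

lemma finite_submultisets: "finite {N. N \<subseteq># M}"
proof (rule finite_subset)
  show "{N. N \<subseteq># M} \<subseteq> mset ` {xs. set xs \<subseteq> set_mset M \<and> length xs \<le> size M}"
  proof
    fix N assume "N \<in> {N. N \<subseteq># M}"
    moreover obtain xs where "mset xs = N" using ex_mset by blast
    ultimately show "N \<in> mset ` {xs. set xs \<subseteq> set_mset M \<and> length xs \<le> size M}"
      by (auto simp: image_iff intro!: exI[of _ xs] size_mset_mono dest: mset_subset_eqD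
        simp flip: size_mset set_mset_mset)
  qed
qed (simp add: finite_lists_length_le)

text \<open>The pair \<open>(w, s)\<close> corresponds to \<open>N = mset (take s w)\<close> and
  \<open>v = drop s w\<close>. Being sorted, the prefix can be recovered from \<open>N\<close>
  alone.\<close>

lemma sum_permutations_sorted_prefix:
  fixes h :: "nat \<Rightarrow> 'b::linorder list \<Rightarrow> 'a::comm_monoid_add"
  shows "(\<Sum>w\<in>permutations_of_multiset M. \<Sum>s | s \<le> length w \<and> sorted (take s w). h s (drop s w))
       = (\<Sum>N | N \<subseteq># M. \<Sum>v\<in>permutations_of_multiset (M - N). h (size N) v)"
proof -
  have len: "length (sorted_list_of_multiset N) = size N" for N :: "'b multiset"
    by (metis mset_sorted_list_of_multiset size_mset)
  let ?S = "\<lambda>w. {s. s \<le> length w \<and> sorted (take s w)}"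
  have "(\<Sum>w\<in>permutations_of_multiset M. \<Sum>s\<in>?S w. h s (drop s w))
     = (\<Sum>(w, s)\<in>(SIGMA w:permutations_of_multiset M. ?S w). h s (drop s w))"
    by (rule sum.Sigma) auto
  also have "\<dots> = (\<Sum>(N, v)\<in>(SIGMA N:{N. N \<subseteq># M}. permutations_of_multiset (M - N)). h (size N) v)"
  proof (rule sum.reindex_bij_witness[where
         i = "\<lambda>(N, v). (sorted_list_of_multiset N @ v, size N)" and
         j = "\<lambda>(w, s). (mset (take s w), drop s w)"], goal_cases)
    case (1 p)
    then show ?case by (auto simp: sorted_sort_id)
  next
    case (2 p)
    obtain w s where p: "p = (w, s)" by force
    have "M = mset (take s w) + mset (drop s w)"
      using 2 by (simp add: p permutations_of_multiset_def flip: mset_append)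
    then show ?case by (simp add: p permutations_of_multiset_def)
  next
    case (3 p)
    then show ?case by (auto simp: len)
  next
    case (4 p)
    then show ?case by (auto simp: len permutations_of_multiset_def size_Diff_submset)
  next
    case (5 p)
    then show ?case by auto
  qed
  also have "\<dots> = (\<Sum>N | N \<subseteq># M. \<Sum>v\<in>permutations_of_multiset (M - N). h (size N) v)"
    by (rule sum.Sigma[symmetric]) (auto simp: finite_submultisets)
  finally show ?thesis .
qed

text \<open>This is the distributive law: a submultiset amounts to an independent choice of a
  multiplicity for each letter. Letters of \<open>A\<close> outside \<open>M\<close> only allow
  multiplicity 0.\<close>

lemma sum_submultisets_prod:
  fixes h :: "'b \<Rightarrow> nat \<Rightarrow> 'a::comm_semiring_1"
  assumes A: "finite A" "set_mset M \<subseteq> A"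
  shows "(\<Sum>N | N \<subseteq># M. \<Prod>x\<in>A. h x (count N x)) = (\<Prod>x\<in>A. \<Sum>c\<le>count M x. h x c)"
proof -
  have cnt: "count (\<Sum>x\<in>A. replicate_mset (g x) x) y = (if y \<in> A then g y else 0)" for g y
    using A(1) by (simp add: count_sum)
  have "(\<Prod>x\<in>A. \<Sum>c\<le>count M x. h x c) = (\<Sum>g\<in>PiE A (\<lambda>x. {..count M x}). \<Prod>x\<in>A. h x (g x))"
    by (rule prod_sum_PiE) (use A in auto)
  also have "\<dots> = (\<Sum>N | N \<subseteq># M. \<Prod>x\<in>A. h x (count N x))"
  proof (rule sum.reindex_bij_witness[where
         i = "\<lambda>N. restrict (count N) A" and
         j = "\<lambda>g. \<Sum>x\<in>A. replicate_mset (g x) x"], goal_cases)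
    case (1 g)
    then show ?case using A by (auto simp: cnt PiE_def extensional_def fun_eq_iff)
  next
    case (2 g)
    then show ?case using A by (auto simp: cnt subseteq_mset_def PiE_iff)
  next
    case (3 N)
    then show ?case
      using A by (auto simp: cnt multiset_eq_iff not_in_iff dest: mset_subset_eqD)
  next
    case (4 N)
    then show ?case by (auto simp: subseteq_mset_def)
  next
    case (5 g)
    then show ?case by (simp add: cnt cong: prod.cong)
  qed
  finally show ?thesis ..
qed

section \<open>Gaussian binomial coefficients\<close>

lemma qv_nonzero: "qv \<noteq> 0"
  by (simp add: qv_def Zero_fract_def eq_fract)

lemma qv_power: "qv ^ k = Fract (monom 1 k) 1"
  by (induction k) (simp_all add: qv_def One_fract_def monom_Suc)

lemma qv_power_neq_1: "k > 0 \<Longrightarrow> qv ^ k \<noteq> 1"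
  by (auto simp: qv_power One_fract_def eq_fract monom_eq_1_iff)

lemma q_fact_0 [simp]: "q_fact 0 = 1"
  by (simp add: q_fact_def)

lemma q_fact_Suc: "q_fact (Suc m) = q_int (Suc m) * q_fact m"
  by (simp add: q_fact_def)

lemma q_int_nonzero: "m > 0 \<Longrightarrow> q_int m \<noteq> 0"
  using qv_power_neq_1[of m] qv_power_neq_1[of 1] by (simp add: q_int_def)

lemma q_fact_nonzero [simp]: "q_fact m \<noteq> 0"
  by (simp add: q_fact_def q_int_nonzero)

lemma q_binomial_0 [simp]: "q_binomial m 0 = 1"
  by (simp add: q_binomial_def)

lemma q_binomial_self [simp]: "q_binomial m m = 1"
  by (simp add: q_binomial_def)

lemma q_int_add: "q_int (a + b) = q_int a + qv ^ a * q_int b"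
  using qv_power_neq_1[of 1] by (simp add: q_int_def divide_simps power_add) (simp add: algebra_simps)

lemma q_binomial_add: "q_binomial (k + m) m = q_fact (k + m) / (q_fact k * q_fact m)"
  by (simp add: q_binomial_def)

lemma q_binomial_Pascal:
  "q_binomial (Suc k + Suc m) (Suc m)
     = q_binomial (k + Suc m) (Suc m) + qv ^ Suc k * q_binomial (Suc k + m) m"
proof -
  have "q_fact (Suc k + Suc m) = (q_int (Suc k) + qv ^ Suc k * q_int (Suc m)) * q_fact (Suc (k + m))"
    unfolding q_int_add[symmetric] using q_fact_Suc[of "Suc (k + m)"] by simp
  \<comment> \<open>Here \<open>A\<close>, \<open>B\<close> stand for the q-integers of
    \<open>Suc k\<close>, \<open>Suc m\<close>, then \<open>f\<close>, \<open>g\<close> for the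
    q-factorials of \<open>k\<close>, \<open>m\<close>, \<open>N\<close> for that of
    \<open>Suc (k + m)\<close>, and \<open>p\<close> for \<open>qv ^ Suc k\<close>.\<close>
  moreover have "(A + p * B) * N / (A * f * (B * g)) = N / (f * (B * g)) + p * (N / (A * f * g))"
    if "A \<noteq> 0" "B \<noteq> 0" "f \<noteq> 0" "g \<noteq> 0" for A B N f g p :: rat_fun
    using that by (simp add: field_simps)
  ultimately show ?thesis unfolding q_binomial_add q_fact_Suc[of k] q_fact_Suc[of m]
    by (simp add: q_int_nonzero)
qed

lemma q_binomial_symmetric: "q_binomial (k + m) m = q_binomial (m + k) k"
  unfolding q_binomial_add by (simp add: add.commute mult.commute)

lemma q_binomial_Pascal':
  "q_binomial (Suc k + Suc m) (Suc m)
     = q_binomial (Suc k + m) m + qv ^ Suc m * q_binomial (k + Suc m) (Suc m)"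
  using q_binomial_Pascal[of m k] by (simp only: q_binomial_symmetric)

text \<open>Iterating \<open>q_binomial_Pascal\<close> in \<open>m\<close> gives the sum. In the
  recursion over words, \<open>c\<close> counts the copies of one letter in the sorted
  prefix.\<close>

lemma q_binomial_expand:
  "q_binomial (Suc k + m) m = (\<Sum>c\<le>m. (qv ^ Suc k) ^ c * q_binomial (k + (m - c)) (m - c))"
proof (induction m)
  case (Suc m)
  show ?case unfolding q_binomial_Pascal Suc sum.atMost_Suc_shift
    by (simp add: sum_distrib_left mult_ac)
qed simp

section \<open>Lattice points of dilated simplices and their weights\<close>

definition dilated_points :: "nat \<Rightarrow> nat \<Rightarrow> int list set" where
  "dilated_points k m = {x. length x = m \<and> (\<forall>c\<in>set x. 0 \<le> c) \<and> sum_list x \<le> int k}"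

lemma dilated_points_0_right: "dilated_points k 0 = {[]}"
  by (auto simp: dilated_points_def)

lemma dilated_points_0_left: "dilated_points 0 m = {replicate m 0}"
proof -
  have "x = replicate (length x) 0" if "\<forall>c\<in>set x. 0 \<le> c" "sum_list x \<le> 0" for x :: "int list"
    using that by (metis antisym sum_list_nonneg sum_list_nonneg_eq_0_iff replicate_length_same)
  then show ?thesis by (auto simp: dilated_points_def sum_list_replicate)
qed

text \<open>On the face with coordinate sum \<open>Suc k\<close> the first coordinate is determined
  by the others; off that face an integral sum is at most \<open>k\<close>.\<close>

lemma dilated_points_Suc_Suc:
  "dilated_points (Suc k) (Suc m) =
     (\<lambda>x. (int (Suc k) - sum_list x) # x) ` dilated_points (Suc k) m \<union> dilated_points k (Suc m)"
proof (intro equalityI subsetI)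
  fix y assume y: "y \<in> dilated_points (Suc k) (Suc m)"
  then obtain a x where ax: "y = a # x" by (cases y) (auto simp: dilated_points_def)
  show "y \<in> (\<lambda>x. (int (Suc k) - sum_list x) # x) ` dilated_points (Suc k) m \<union> dilated_points k (Suc m)"
  proof (cases "sum_list y = int (Suc k)")
    case True
    then have "y = (int (Suc k) - sum_list x) # x" by (simp add: ax)
    moreover have "x \<in> dilated_points (Suc k) m"
      using y True by (auto simp: ax dilated_points_def)
    ultimately show ?thesis by blast
  qed (use y in \<open>auto simp: dilated_points_def\<close>)
qed (auto simp: dilated_points_def)

lemma finite_dilated_points: "finite (dilated_points k m)"
proof (induction k arbitrary: m)
  case (Suc k)
  show ?case by (induction m) (auto simp: dilated_points_0_right dilated_points_Suc_Suc Suc)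
qed (simp add: dilated_points_0_left)

text \<open>Only the summand \<open>i = 1\<close> involves the first coordinate. It vanishes on the
  face with coordinate sum \<open>k\<close>, so dropping that coordinate there preserves the
  weight.\<close>

lemma mu_Cons:
  assumes "length x = m"
  shows "mu k (Suc m) (a # x) = int k - (a + sum_list x) + mu k m x"
proof -
  have shift: "(\<Sum>l=Suc i..Suc m. (a # x) ! (l - 1)) = (\<Sum>l=i..m. x ! (l - 1))" if "i \<ge> 1" for i
    unfolding sum.shift_bounds_cl_Suc_ivl by (rule sum.cong) (use that in \<open>auto simp: nth_Cons'\<close>)
  have "(\<Sum>l=1..Suc m. (a # x) ! (l - 1)) = sum_list (a # x)"
    unfolding sum_list_sum_nth using assms
    by (simp only: One_nat_def sum.shift_bounds_cl_Suc_ivl) (simp add: atLeastLessThanSuc_atLeastAtMost)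
  then show ?thesis unfolding mu_def
    by (subst sum.atLeast_Suc_atMost) (auto simp: sum.shift_bounds_cl_Suc_ivl shift simp del: sum.cl_ivl_Suc)
qed

lemma mu_Suc: "mu (Suc k) m x = mu k m x + int m"
proof -
  have "mu (Suc k) m x = (\<Sum>i=1..m. (int k - (\<Sum>l=i..m. x ! (l - 1))) + 1)"
    unfolding mu_def by (rule sum.cong) auto
  then show ?thesis unfolding sum.distrib mu_def by simp
qed

text \<open>The face contributes the sum for \<open>m\<close> unchanged, and the points of the
  smaller dilate gain \<open>qv ^ Suc m\<close> by \<open>mu_Suc\<close>. This matches
  \<open>q_binomial_Pascal'\<close>.\<close>

lemma sum_dilated_points:
  "(\<Sum>x\<in>dilated_points k m. qv powi mu k m x) = q_binomial (k + m) m"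
proof (induction k arbitrary: m)
  case 0
  have "mu 0 m (replicate m 0) = 0" unfolding mu_def by (auto intro!: sum.neutral)
  then show ?case by (simp add: dilated_points_0_left)
next
  case (Suc k)
  note IH = Suc
  show ?case
  proof (induction m)
    case 0
    show ?case by (simp add: dilated_points_0_right mu_def)
  next
    case (Suc m)
    let ?f = "\<lambda>x. (int (Suc k) - sum_list x) # x"
    have "(\<Sum>x\<in>dilated_points (Suc k) (Suc m). qv powi mu (Suc k) (Suc m) x) =
      (\<Sum>x\<in>?f ` dilated_points (Suc k) m. qv powi mu (Suc k) (Suc m) x) +
      (\<Sum>x\<in>dilated_points k (Suc m). qv powi mu (Suc k) (Suc m) x)"
      unfolding dilated_points_Suc_Suc
      by (rule sum.union_disjoint) (auto simp: finite_dilated_points, auto simp: dilated_points_def)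
    also have "(\<Sum>x\<in>?f ` dilated_points (Suc k) m. qv powi mu (Suc k) (Suc m) x) =
        (\<Sum>x\<in>dilated_points (Suc k) m. qv powi mu (Suc k) m x)"
    proof (subst sum.reindex)
      show "inj_on ?f (dilated_points (Suc k) m)" by (auto simp: inj_on_def)
    qed (auto simp: dilated_points_def mu_Cons intro!: sum.cong)
    also have "\<dots> = q_binomial (Suc k + m) m" by (rule Suc)
    also have "(\<Sum>x\<in>dilated_points k (Suc m). qv powi mu (Suc k) (Suc m) x)
       = qv ^ Suc m * (\<Sum>x\<in>dilated_points k (Suc m). qv powi mu k (Suc m) x)"
      unfolding mu_Suc by (simp only: power_int_add qv_nonzero sum_distrib_left power_int_of_nat simp_thms mult.commute)
    also have "(\<Sum>x\<in>dilated_points k (Suc m). qv powi mu k (Suc m) x) = q_binomial (k + Suc m) (Suc m)"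
      by (rule IH)
    finally show ?case unfolding q_binomial_Pascal' .
  qed
qed

lemma std_simplex_dilated_points:
  "map real_of_int b \<in> map (\<lambda>c. real k * c) ` std_simplex m \<longleftrightarrow> b \<in> dilated_points k m"
proof
  assume "map real_of_int b \<in> map (\<lambda>c. real k * c) ` std_simplex m"
  then obtain y where y: "map real_of_int b = map (\<lambda>c. real k * c) y" "y \<in> std_simplex m" by auto
  have len: "length b = m" using arg_cong[OF y(1), of length] y(2) by (simp add: std_simplex_def)
  have "real_of_int c \<ge> 0" if "c \<in> set b" for c
  proof -
    have "real_of_int c \<in> set (map (\<lambda>c. real k * c) y)"
      using that by (simp flip: y(1))
    then obtain z where "real_of_int c = real k * z" "z \<in> set y" by auto
    then show ?thesis using y(2) by (simp only:) (simp add: std_simplex_def)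
  qed
  moreover have "real_of_int (sum_list b) = sum_list (map (\<lambda>c. real k * c) y)"
    unfolding y(1)[symmetric] by (induction b) auto
  moreover have "\<dots> = real k * sum_list y" by (simp add: sum_list_const_mult)
  moreover have "\<dots> \<le> real k * 1" using y(2) by (intro mult_left_mono) (auto simp: std_simplex_def)
  ultimately show "b \<in> dilated_points k m" using len by (auto simp: dilated_points_def)
next
  assume b: "b \<in> dilated_points k m"
  show "map real_of_int b \<in> map (\<lambda>c. real k * c) ` std_simplex m"
  \<comment> \<open>The dilate by 0 is the origin alone, so the zero vector is the preimage; for
    positive \<open>k\<close> the preimage is \<open>b\<close> divided by \<open>k\<close>.\<close>
  proof (cases "k = 0")
    case True
    then have "b = replicate m 0" using b by (simp add: dilated_points_0_left)
    then show ?thesis using True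
      by (intro image_eqI[of _ _ "replicate m 0"]) (auto simp: std_simplex_def sum_list_replicate)
  next
    case False
    let ?y = "map (\<lambda>c. real_of_int c / real k) b"
    have "sum_list ?y = real_of_int (sum_list b) / real k"
      by (induction b) (auto simp: add_divide_distrib)
    moreover have "real_of_int (sum_list b) \<le> real k" using b by (simp add: dilated_points_def)
    ultimately have "?y \<in> std_simplex m" using b False by (auto simp: std_simplex_def dilated_points_def)
    then show ?thesis using False by (intro image_eqI[of _ _ ?y]) auto
  qed
qed

lemma lattice_points_dilate_simplex_prod:
  "lattice_points (dilate k (simplex_prod \<eta>)) = listset (map (dilated_points k) \<eta>)"
proof -
  have "map (map real_of_int) x \<in> map (map (\<lambda>c. real k * c)) ` listset (map std_simplex \<eta>)
      \<longleftrightarrow> x \<in> listset (map (dilated_points k) \<eta>)" for x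
  proof (induction \<eta> arbitrary: x)
    case (Cons m \<eta>)
    show ?case
    proof (cases x)
      case (Cons b bs)
      have "map (map real_of_int) x \<in> map (map (\<lambda>c. real k * c)) ` listset (map std_simplex (m # \<eta>)) \<longleftrightarrow>
         map real_of_int b \<in> map (\<lambda>c. real k * c) ` std_simplex m \<and>
         map (map real_of_int) bs \<in> map (map (\<lambda>c. real k * c)) ` listset (map std_simplex \<eta>)"
        by (auto simp: Cons set_Cons_def image_iff) (metis list.simps(9))
      then show ?thesis unfolding Cons.IH std_simplex_dilated_points by (simp add: Cons set_Cons_def)
    qed (auto simp: set_Cons_def)
  qed auto
  then show ?thesis by (simp add: lattice_points_def dilate_def simplex_prod_def)
qed

lemma mu_prod_Cons: "mu_prod (m # \<eta>) k (b # x) = mu k m b + mu_prod \<eta> k x"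
  unfolding mu_prod_def length_Cons
  by (subst sum.atLeast_Suc_atMost) (auto simp: sum.shift_bounds_cl_Suc_ivl nth_Cons' simp del: sum.cl_ivl_Suc intro!: sum.cong)

lemma prod_nth_eq_prod_list:
  fixes f :: "nat \<Rightarrow> 'a::comm_monoid_mult"
  shows "(\<Prod>i=1..length \<eta>. f (\<eta> ! (i - 1))) = prod_list (map f \<eta>)"
proof (induction \<eta>)
  case (Cons m \<eta>)
  have "(\<Prod>i=1..length (m # \<eta>). f ((m # \<eta>) ! (i - 1))) = f m * (\<Prod>i=1..length \<eta>. f (\<eta> ! (i - 1)))"
    unfolding length_Cons
    by (subst prod.atLeast_Suc_atMost)
      (auto simp: prod.shift_bounds_cl_Suc_ivl nth_Cons' simp del: prod.cl_ivl_Suc intro!: prod.cong)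
  then show ?case using Cons by simp
qed simp

text \<open>The weight is additive over the blocks, so the sum over the product set factors.\<close>

lemma sum_simplex_prod:
  "(\<Sum>x\<in>listset (map (dilated_points k) \<eta>). qv powi mu_prod \<eta> k x)
     = prod_list (map (\<lambda>m. q_binomial (k + m) m) \<eta>)"
proof (induction \<eta>)
  case Nil
  show ?case by (simp add: mu_prod_def)
next
  case (Cons m \<eta>)
  let ?A = "dilated_points k m" and ?B = "listset (map (dilated_points k) \<eta>)"
  have *: "listset (map (dilated_points k) (m # \<eta>)) = (\<lambda>(b, x). b # x) ` (?A \<times> ?B)"
    by (auto simp: set_Cons_def)
  have "(\<Sum>x\<in>listset (map (dilated_points k) (m # \<eta>)). qv powi mu_prod (m # \<eta>) k x)
     = (\<Sum>(b, x)\<in>?A \<times> ?B. qv powi mu k m b * qv powi mu_prod \<eta> k x)"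
    unfolding * by (subst sum.reindex)
      (auto simp: inj_on_def mu_prod_Cons power_int_add qv_nonzero intro!: sum.cong)
  also have "\<dots> = (\<Sum>b\<in>?A. qv powi mu k m b) * (\<Sum>x\<in>?B. qv powi mu_prod \<eta> k x)"
    by (simp add: sum_product sum.cartesian_product)
  finally show ?case unfolding Cons sum_dilated_points by simp
qed

section \<open>Summation over multiset permutations and conclusion\<close>

text \<open>The induction on \<open>k\<close> needs arbitrary \<open>M\<close>, since removing the
  sorted prefix leaves \<open>M - N\<close>. The fixed index set \<open>A\<close> remains valid when
  letters disappear.\<close>

lemma sum_permutations_compat_gf:
  fixes M :: "'b::linorder multiset"
  assumes "finite A" "set_mset M \<subseteq> A"
  shows "(\<Sum>w\<in>permutations_of_multiset M. compat_gf qv w k)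
           = (\<Prod>x\<in>A. q_binomial (k + count M x) (count M x))"
  using assms(2)
proof (induction k arbitrary: M)
  case 0
  have "w = sorted_list_of_multiset M" if "mset w = M" "sorted w" for w
    using that by (metis sorted_list_of_multiset_mset sorted_sort_id)
  then have "permutations_of_multiset M \<inter> {w. sorted w} = {sorted_list_of_multiset M}"
    by (auto simp: permutations_of_multiset_def)
  then show ?case by (simp add: compat_gf_0 sum.If_cases of_bool_def)
next
  case (Suc k)
  let ?p = "qv ^ Suc k"
  have "(\<Sum>w\<in>permutations_of_multiset M. compat_gf qv w (Suc k))
      = (\<Sum>N | N \<subseteq># M. \<Sum>v\<in>permutations_of_multiset (M - N). ?p ^ size N * compat_gf qv v k)"
    unfolding compat_gf_Suc by (rule sum_permutations_sorted_prefix)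
  also have "\<dots> = (\<Sum>N | N \<subseteq># M. \<Prod>x\<in>A. ?p ^ count N x *
      q_binomial (k + (count M x - count N x)) (count M x - count N x))"
  proof (rule sum.cong)
    fix N assume "N \<in> {N. N \<subseteq># M}"
    then have N: "set_mset N \<subseteq> A" "set_mset (M - N) \<subseteq> A"
      using Suc.prems by (auto dest: mset_subset_eqD in_diffD)
    have "size N = (\<Sum>x\<in>A. count N x)"
      unfolding size_multiset_overloaded_eq using assms(1) N(1)
      by (intro sum.mono_neutral_left) (auto simp: not_in_iff)
    then show "(\<Sum>v\<in>permutations_of_multiset (M - N). ?p ^ size N * compat_gf qv v k) = (\<Prod>x\<in>A. ?p ^ count N x *
      q_binomial (k + (count M x - count N x)) (count M x - count N x))"
      using Suc.IH[OF N(2)] by (simp add: prod.distrib power_sum flip: sum_distrib_left)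
  qed simp
  also have "\<dots> = (\<Prod>x\<in>A. \<Sum>c\<le>count M x. ?p ^ c * q_binomial (k + (count M x - c)) (count M x - c))"
    by (rule sum_submultisets_prod) (use assms(1) Suc.prems in auto)
  also have "\<dots> = (\<Prod>x\<in>A. q_binomial (Suc k + count M x) (count M x))"
    by (simp only: q_binomial_expand)
  finally show ?case .
qed

theorem theorem3p1:
  fixes \<eta> :: "nat list" and n :: nat
  assumes "\<forall>m\<in>set \<eta>. 1 \<le> m"
    and "sum_list \<eta> = n"
  shows "C_poly \<eta> / (\<Prod>i=0..n. 1 - fps_const (qv ^ i) * fps_X)
           = Abs_fps (\<lambda>k. \<Prod>i=1..length \<eta>. q_binomial (k + \<eta> ! (i - 1)) (\<eta> ! (i - 1)))
       \<and> Abs_fps (\<lambda>k. \<Prod>i=1..length \<eta>. q_binomial (k + \<eta> ! (i - 1)) (\<eta> ! (i - 1)))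
           = weighted_Ehr (simplex_prod \<eta>) (mu_prod \<eta>)"
proof
  define M where "M = (\<Sum>j\<in>{1..length \<eta>}. replicate_mset (\<eta> ! (j - 1)) j)"
  have count_M: "count M j = (if j \<in> {1..length \<eta>} then \<eta> ! (j - 1) else 0)" for j
    by (auto simp: M_def count_sum)
  have M: "set_mset M \<subseteq> {1..length \<eta>}"
    by (auto simp: count_M simp flip: count_greater_zero_iff split: if_splits)
  have "size M = (\<Sum>j=1..length \<eta>. \<eta> ! (j - 1))"
    by (simp add: M_def)
  also have "\<dots> = n"
    by (simp add: sum_list_sum_nth atLeast0LessThan sum.atLeast1_atMost_eq flip: assms(2))
  \<comment> \<open>The denominator in \<open>compat_gf_fps\<close> depends on \<open>w\<close> only
    through its length, so all words share \<open>?P\<close>.\<close>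
  finally have len: "length w = n" if "w \<in> multiset_perms \<eta>" for w
    using that by (auto simp: multiset_perms_def M_def permutations_of_multiset_def simp flip: size_mset)
  let ?S = "Abs_fps (\<lambda>k. \<Prod>i=1..length \<eta>. q_binomial (k + \<eta> ! (i - 1)) (\<eta> ! (i - 1)))"
  let ?P = "\<Prod>i=0..n. 1 - fps_const (qv ^ i) * fps_X"
  have "?S = (\<Sum>w\<in>multiset_perms \<eta>. Abs_fps (compat_gf qv w))"
  proof (rule fps_ext)
    fix k
    have "(\<Sum>w\<in>multiset_perms \<eta>. compat_gf qv w k) = (\<Prod>j=1..length \<eta>. q_binomial (k + count M j) (count M j))"
      unfolding multiset_perms_def M_def[symmetric] using M by (rule sum_permutations_compat_gf[rotated]) simp
    then show "?S $ k = (\<Sum>w\<in>multiset_perms \<eta>. Abs_fps (compat_gf qv w)) $ k"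
      by (simp add: fps_sum_nth count_M)
  qed
  then have "?S * ?P = (\<Sum>w\<in>multiset_perms \<eta>. Abs_fps (compat_gf qv w) * ?P)"
    by (simp only: sum_distrib_right)
  also have "\<dots> = C_poly \<eta>"
    unfolding C_poly_def by (rule sum.cong) (use compat_gf_fps len in \<open>auto simp flip: len\<close>)
  finally have "C_poly \<eta> = ?S * ?P" ..
  moreover have "?P \<noteq> 0"
  proof -
    have "?P $ 0 = 1" by (simp add: fps_prod_nth')
    then show ?thesis by auto
  qed
  ultimately show "C_poly \<eta> / ?P = ?S" by simp
  show "?S = weighted_Ehr (simplex_prod \<eta>) (mu_prod \<eta>)"
    unfolding weighted_Ehr_def lattice_points_dilate_simplex_prod sum_simplex_prod
    by (simp only: prod_nth_eq_prod_list[where f = "\<lambda>m. q_binomial (_ + m) m"])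
qed

end
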